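(* Let $R$ be a superring. If $(A,\mathfrak p)$ is a valuation pair of $R$, then there is a valuation $v$ on $R$ such that $A=A_v$ and $\mathfrak p=\mathfrak p_v$. Conversely, for every valuation $v$ on $R$, the pair $(A_v,\mathfrak p_v)$ is a valuation pair of $R$.
   Context: A superring is a $\mathbb Z/2$-graded unital ring $R=R_{\overline 0}\oplus R_{\overline 1}$ with $1\neq 0$, assumed supercommutative: $R_{\overline 0}$ is central in $R$ and every element of $R_{\overline 1}$ squares to zero. A subsuperring $A\subseteq R$ is a subring with the same unit and compatible grading ($A_i=A\cap R_i$). An ideal $\mathfrak p$ of a superring $A$ is prime if $A/\mathfrak p$ is an integral domain; any prime ideal is graded and contains $A_{\overline 1}$; write $\mathfrak p_{\overline 0}=\mathfrak p\cap A_{\overline 0}$. Put $\mathfrak J_R=R\cdot R_{\overline 1}=R_{\overline 1}^2\oplus R_{\overline 1}$. A valuation on $R$ is a surjective map $v:R\to\mathbb G\cup\{\infty\}$, where $(\mathbb G,+,0)$ is a totally ordered abelian group (order invariant under translation) and $\infty$ is a symbol with $\infty>\alpha$ for $\alpha\in\mathbb G$ and $\infty+\alpha=\alpha+\infty=\infty+\infty=\infty$, such that $v(0)=\infty$, $v(1)=0$, $v(xy)=v(x)+v(y)$ and $v(x+y)\ge\min\{v(x),v(y)\}$ for all $x,y\in R$. Put $A_v=\{x\in R\mid v(x)\ge 0\}$ and $\mathfrak p_v=\{x\in R\mid v(x)>0\}$. A valuation pair of $R$ is a pair $(A,\mathfrak p)$ such that: (i) $A$ is a subsuperring of $R$ and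 $\mathfrak p$ is a prime ideal of $A$ containing $\mathfrak J_R$; (ii) for every $x\in R\setminus A$ there exists $x'\in\mathfrak p_{\overline 0}$ with $xx'\in A\setminus\mathfrak p$. *)

theory Defs
  imports "HOL-Algebra.Algebra" "HOL-Library.Z2"
begin

text \<open>
  The grading of a superring is a family of additive subgroups indexed by the two-element type
  \<^typ>\<open>bit\<close>, whose addition is that of Z/2.  Associativity and the unit come from \<^locale>\<open>ring\<close>,
  which is neither commutative nor nontrivial.  That the unit is even follows from the axioms.
\<close>

locale superring = ring R for R (structure) +
  fixes Gr :: "bit \<Rightarrow> 'a set"
  assumes grade_subgroup: "subgroup (Gr i) (add_monoid R)"
    and grade_sum: "Gr 0 <+> Gr 1 = carrier R"
    and grade_Int: "Gr 0 \<inter> Gr 1 = {\<zero>}"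
    and grade_mult: "\<lbrakk>x \<in> Gr i; y \<in> Gr j\<rbrakk> \<Longrightarrow> x \<otimes> y \<in> Gr (i + j)"
    and one_neq_zero: "\<one> \<noteq> \<zero>"
    and even_central: "\<lbrakk>x \<in> Gr 0; y \<in> carrier R\<rbrakk> \<Longrightarrow> x \<otimes> y = y \<otimes> x"
    and odd_square: "x \<in> Gr 1 \<Longrightarrow> x \<otimes> x = \<zero>"

definition subsuperring :: "('a, 'm) ring_scheme \<Rightarrow> (bit \<Rightarrow> 'a set) \<Rightarrow> 'a set \<Rightarrow> bool" where
  "subsuperring R Gr A \<longleftrightarrow>
     subring A R \<and> superring (R\<lparr>carrier := A\<rparr>) (\<lambda>i. A \<inter> Gr i)"

text \<open>The library's \<^locale>\<open>primeideal\<close> presupposes a commutative ring, so it is not usable here.\<close>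

definition prime_superideal :: "'a set \<Rightarrow> ('a, 'm) ring_scheme \<Rightarrow> bool" where
  "prime_superideal P A \<longleftrightarrow> ideal P A \<and> domain (A Quot P)"

text \<open>
  \<^const>\<open>ideal_prod\<close> consists of the finite sums of products and makes sense for arbitrary factors,
  so this is the set of finite sums of products of a ring element and an odd element.
\<close>

definition odd_ideal :: "('a, 'm) ring_scheme \<Rightarrow> (bit \<Rightarrow> 'a set) \<Rightarrow> 'a set" where
  "odd_ideal R Gr = carrier R \<cdot>\<^bsub>R\<^esub> Gr 1"

definition valuation_pair ::
    "('a, 'm) ring_scheme \<Rightarrow> (bit \<Rightarrow> 'a set) \<Rightarrow> 'a set \<Rightarrow> 'a set \<Rightarrow> bool" where
  "valuation_pair R Gr A P \<longleftrightarrow>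
     subsuperring R Gr A \<and>
     prime_superideal P (R\<lparr>carrier := A\<rparr>) \<and>
     odd_ideal R Gr \<subseteq> P \<and>
     (\<forall>x \<in> carrier R - A. \<exists>x' \<in> P \<inter> (A \<inter> Gr 0). x \<otimes>\<^bsub>R\<^esub> x' \<in> A - P)"

text \<open>
  The value group is written multiplicatively, following \<^locale>\<open>comm_group\<close>: its
  operation and unit are the addition and the zero of the usual additive notation for valuations.
  The order is a relation on the carrier, a pair \<^term>\<open>(a, b)\<close> in it meaning that \<^term>\<open>a\<close> is at
  most \<^term>\<open>b\<close>; \<^const>\<open>linear_order_on\<close> is the reflexive (non-strict) notion.
\<close>

locale totally_ordered_comm_group = comm_group G for G (structure) +
  fixes ord_rel :: "('a \<times> 'a) set"
  assumes linear_order: "linear_order_on (carrier G) ord_rel"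
    and translation_invariant:
      "\<lbrakk>(a, b) \<in> ord_rel; c \<in> carrier G\<rbrakk> \<Longrightarrow> (c \<otimes> a, c \<otimes> b) \<in> ord_rel"

datatype 'g with_infty = Fin 'g | Infty

fun infty_add ::
    "('g, 'n) monoid_scheme \<Rightarrow> 'g with_infty \<Rightarrow> 'g with_infty \<Rightarrow> 'g with_infty" where
  "infty_add G (Fin a) (Fin b) = Fin (a \<otimes>\<^bsub>G\<^esub> b)"
| "infty_add G Infty b = Infty"
| "infty_add G a Infty = Infty"

fun infty_le :: "('g \<times> 'g) set \<Rightarrow> 'g with_infty \<Rightarrow> 'g with_infty \<Rightarrow> bool" where
  "infty_le ord_rel (Fin a) (Fin b) \<longleftrightarrow> (a, b) \<in> ord_rel"
| "infty_le ord_rel a Infty \<longleftrightarrow> True"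
| "infty_le ord_rel Infty (Fin b) \<longleftrightarrow> False"

definition infty_less :: "('g \<times> 'g) set \<Rightarrow> 'g with_infty \<Rightarrow> 'g with_infty \<Rightarrow> bool" where
  "infty_less ord_rel a b \<longleftrightarrow> infty_le ord_rel a b \<and> a \<noteq> b"

definition infty_min ::
    "('g \<times> 'g) set \<Rightarrow> 'g with_infty \<Rightarrow> 'g with_infty \<Rightarrow> 'g with_infty" where
  "infty_min ord_rel a b = (if infty_le ord_rel a b then a else b)"

text \<open>Only the values of \<^term>\<open>v\<close> on the carrier of \<^term>\<open>R\<close> matter.\<close>

definition valuation ::
    "('a, 'm) ring_scheme \<Rightarrow> ('g, 'n) monoid_scheme \<Rightarrow> ('g \<times> 'g) set \<Rightarrow>
     ('a \<Rightarrow> 'g with_infty) \<Rightarrow> bool" where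
  "valuation R G ord_rel v \<longleftrightarrow>
     totally_ordered_comm_group G ord_rel \<and>
     v ` carrier R = insert Infty (Fin ` carrier G) \<and>
     v \<zero>\<^bsub>R\<^esub> = Infty \<and>
     v \<one>\<^bsub>R\<^esub> = Fin \<one>\<^bsub>G\<^esub> \<and>
     (\<forall>x \<in> carrier R. \<forall>y \<in> carrier R. v (x \<otimes>\<^bsub>R\<^esub> y) = infty_add G (v x) (v y)) \<and>
     (\<forall>x \<in> carrier R. \<forall>y \<in> carrier R.
        infty_le ord_rel (infty_min ord_rel (v x) (v y)) (v (x \<oplus>\<^bsub>R\<^esub> y)))"

definition valuation_subring ::
    "('a, 'm) ring_scheme \<Rightarrow> ('g, 'n) monoid_scheme \<Rightarrow> ('g \<times> 'g) set \<Rightarrow>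
     ('a \<Rightarrow> 'g with_infty) \<Rightarrow> 'a set" where
  "valuation_subring R G ord_rel v = {x \<in> carrier R. infty_le ord_rel (Fin \<one>\<^bsub>G\<^esub>) (v x)}"

definition valuation_prime ::
    "('a, 'm) ring_scheme \<Rightarrow> ('g, 'n) monoid_scheme \<Rightarrow> ('g \<times> 'g) set \<Rightarrow>
     ('a \<Rightarrow> 'g with_infty) \<Rightarrow> 'a set" where
  "valuation_prime R G ord_rel v = {x \<in> carrier R. infty_less ord_rel (Fin \<one>\<^bsub>G\<^esub>) (v x)}"

end

theory Submission
  imports Defs
begin

text \<open>
  The values of the valuation belonging to a valuation pair \<open>(A, P)\<close> can be read off from
  divisibility by \<open>P\<close>: if \<open>v\<close> is surjective with \<open>P = {x. v x > 0}\<close>, then the conductor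
  \<open>{z. x z \<in> P}\<close> is \<open>{z. v z > - v x}\<close> for finite \<open>v x\<close> and the whole ring for
  \<open>v x = \<infinity>\<close>; it grows with \<open>v x\<close> and determines it.  So the
  conductors themselves are taken as values, ordered by inclusion; the whole ring plays the part
  of \<open>\<infinity>\<close> and \<open>P\<close>, the conductor of \<open>\<one>\<close>, that of \<open>0\<close>.

  This works as for Manis valuations of commutative rings.  The point is that every \<open>x \<notin> P\<close> can be
  multiplied by some element of \<open>A\<close> into \<open>A - P\<close>, on which \<open>P\<close> is detected by primality.  If two
  conductors were incomparable, there would be \<open>z\<close> and \<open>w\<close> with \<open>x z, y w \<in> P\<close> and, after such
  multiplications, \<open>y z, x w \<in> A - P\<close>; the product of all four elements would then both lie and
  not lie in \<open>P\<close> (\<open>conductor_linear\<close>).  Elements of \<open>A - P\<close> have conductor \<open>P\<close>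
  (\<open>conductor_unit\<close>), so multiplication into \<open>A - P\<close> also yields inverses of finite values.

  Such arguments reorder the factors of a product.  A superring is commutative modulo its odd
  ideal (\<open>commutator_in_odd_ideal\<close>), and \<open>P\<close> contains that ideal, so reordering does not change
  membership in \<open>P\<close>.

  Conversely, an odd \<open>x\<close> has \<open>2 v x = v 0 = \<infinity>\<close>, so a valuation is infinite on the odd ideal
  and depends only on the even part of its argument.  Hence its ring of non-negative elements is
  graded, the quotient by the positive elements is commutative, and a multiplier for \<open>x\<close> with
  \<open>v x < 0\<close> is the even part of any \<open>y\<close> with \<open>v y = - v x\<close>
  (\<open>Pv_lift\<close>).
\<close>

section \<open>Quotients that are integral domains\<close>

text \<open>
  Primality in terms of elements.  Over a noncommutative ring the commutativity of the quotient
  becomes a condition of its own, on commutators.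
\<close>

lemma domain_Quot_iff:
  fixes R (structure)
  assumes "ideal I R"
  shows "domain (R Quot I) \<longleftrightarrow>
    \<one> \<notin> I \<and> (\<forall>a\<in>carrier R. \<forall>b\<in>carrier R. a \<otimes> b \<ominus> b \<otimes> a \<in> I) \<and>
    (\<forall>a\<in>carrier R. \<forall>b\<in>carrier R. a \<otimes> b \<in> I \<longrightarrow> a \<in> I \<or> b \<in> I)"
proof -
  interpret ideal I R by fact
  let ?Q = "R Quot I"
  interpret Q: ring ?Q by (rule quotient_is_ring)
  have zero_iff: "I +> a = I \<longleftrightarrow> a \<in> I" if "a \<in> carrier R" for a
    using that rcos_const_imp_mem a_rcos_const by blast
  have eq_iff: "I +> a = I +> b \<longleftrightarrow> a \<ominus> b \<in> I" if "a \<in> carrier R" "b \<in> carrier R" for a b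
    using quotient_eq_iff_same_a_r_cos[OF assms that] by simp
  have carrier_Q: "carrier ?Q = (\<lambda>a. I +> a) ` carrier R"
    by (auto simp: FactRing_simps)
  have mult_Q: "(I +> a) \<otimes>\<^bsub>?Q\<^esub> (I +> b) = I +> a \<otimes> b" if "a \<in> carrier R" "b \<in> carrier R" for a b
    using that by (simp add: FactRing_def rcoset_mult_add)
  have zero_Q: "\<zero>\<^bsub>?Q\<^esub> = I" and one_Q: "\<one>\<^bsub>?Q\<^esub> = I +> \<one>"
    by (simp_all add: FactRing_def)
  show ?thesis
  proof
    assume "domain ?Q"
    then interpret D: domain ?Q .
    have "\<one> \<notin> I"
      using D.one_not_zero zero_iff[of \<one>] zero_Q one_Q by simp
    moreover have "a \<otimes> b \<ominus> b \<otimes> a \<in> I" if "a \<in> carrier R" "b \<in> carrier R" for a b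
      using D.m_comm[of "I +> a" "I +> b"] that by (simp add: carrier_Q mult_Q flip: eq_iff)
    moreover have "a \<in> I \<or> b \<in> I" if "a \<in> carrier R" "b \<in> carrier R" "a \<otimes> b \<in> I" for a b
      using D.integral[of "I +> a" "I +> b"] that by (simp add: carrier_Q mult_Q zero_Q zero_iff)
    ultimately show "\<one> \<notin> I \<and> (\<forall>a\<in>carrier R. \<forall>b\<in>carrier R. a \<otimes> b \<ominus> b \<otimes> a \<in> I) \<and>
        (\<forall>a\<in>carrier R. \<forall>b\<in>carrier R. a \<otimes> b \<in> I \<longrightarrow> a \<in> I \<or> b \<in> I)"
      by blast
  next
    assume *: "\<one> \<notin> I \<and> (\<forall>a\<in>carrier R. \<forall>b\<in>carrier R. a \<otimes> b \<ominus> b \<otimes> a \<in> I) \<and>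
        (\<forall>a\<in>carrier R. \<forall>b\<in>carrier R. a \<otimes> b \<in> I \<longrightarrow> a \<in> I \<or> b \<in> I)"
    have comm: "s \<otimes>\<^bsub>?Q\<^esub> t = t \<otimes>\<^bsub>?Q\<^esub> s" if "s \<in> carrier ?Q" "t \<in> carrier ?Q" for s t
    proof -
      obtain a b where ab: "a \<in> carrier R" "b \<in> carrier R" "s = I +> a" "t = I +> b"
        using \<open>s \<in> carrier ?Q\<close> \<open>t \<in> carrier ?Q\<close> by (auto simp: carrier_Q)
      then have "I +> a \<otimes> b = I +> b \<otimes> a"
        using * by (subst eq_iff) auto
      then show ?thesis
        using ab by (simp add: mult_Q)
    qed
    show "domain ?Q"
    proof (rule domain.intro)
      show "cring ?Q"
        using comm by (intro cring.intro Q.ring_axioms comm_monoid.intro Q.monoid_axioms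
            comm_monoid_axioms.intro)
      show "domain_axioms ?Q"
      proof
        show "\<one>\<^bsub>?Q\<^esub> \<noteq> \<zero>\<^bsub>?Q\<^esub>"
          using * zero_iff[of \<one>] by (simp add: zero_Q one_Q)
        show "s = \<zero>\<^bsub>?Q\<^esub> \<or> t = \<zero>\<^bsub>?Q\<^esub>"
          if st: "s \<otimes>\<^bsub>?Q\<^esub> t = \<zero>\<^bsub>?Q\<^esub>" "s \<in> carrier ?Q" "t \<in> carrier ?Q" for s t
        proof -
          obtain a b where ab: "a \<in> carrier R" "b \<in> carrier R" "s = I +> a" "t = I +> b"
            using st by (auto simp: carrier_Q)
          then have "a \<in> I \<or> b \<in> I"
            using * st(1) by (simp add: mult_Q zero_Q zero_iff)
          then show ?thesis
            using ab by (simp add: zero_Q zero_iff)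
        qed
      qed
    qed
  qed
qed


section \<open>Conductors into the prime of a Manis pair\<close>

text \<open>
  Assumption \<open>P_swap\<close> replaces commutativity: the order of factors is irrelevant for membership
  in \<open>P\<close>.  Swapping the first two factors suffices, because \<open>z = \<one>\<close> gives cyclic rotation
  of longer products, and rotations and one transposition generate all permutations.
\<close>

locale manis_pair = ring R for R (structure) +
  fixes A P :: "'a set"
  assumes A_subring: "subring A R"
    and P_subgroup: "additive_subgroup P R"
    and P_subset: "P \<subseteq> A"
    and P_r_closed: "\<lbrakk>p \<in> P; a \<in> A\<rbrakk> \<Longrightarrow> p \<otimes> a \<in> P"
    and one_notin_P: "\<one> \<notin> P"
    and P_prime: "\<lbrakk>a \<in> A; b \<in> A; a \<otimes> b \<in> P\<rbrakk> \<Longrightarrow> a \<in> P \<or> b \<in> P"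
    and P_swap: "\<lbrakk>x \<in> carrier R; y \<in> carrier R; z \<in> carrier R; x \<otimes> y \<otimes> z \<in> P\<rbrakk> \<Longrightarrow> y \<otimes> x \<otimes> z \<in> P"
    and P_lift: "x \<in> carrier R - A \<Longrightarrow> \<exists>y\<in>P. x \<otimes> y \<in> A - P"
begin

lemma A_carrier: "a \<in> A \<Longrightarrow> a \<in> carrier R"
  using subringE(1)[OF A_subring] by blast

lemma P_A: "p \<in> P \<Longrightarrow> p \<in> A"
  using P_subset by blast

lemma P_rotate:
  assumes "x \<in> carrier R" "y \<in> carrier R" "x \<otimes> y \<in> P"
  shows "y \<otimes> x \<in> P"
  using P_swap[of x y \<one>] assms by simp

lemma P_swap_inner:
  assumes "u \<in> carrier R" "x \<in> carrier R" "y \<in> carrier R" "w \<in> carrier R"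
    and "u \<otimes> x \<otimes> (y \<otimes> w) \<in> P"
  shows "u \<otimes> y \<otimes> (x \<otimes> w) \<in> P"
proof -
  have "x \<otimes> y \<otimes> (w \<otimes> u) \<in> P"
    using P_rotate[of u "x \<otimes> (y \<otimes> w)"] assms by (simp add: m_assoc)
  then have "y \<otimes> x \<otimes> (w \<otimes> u) \<in> P"
    using P_swap assms by simp
  then show ?thesis
    using P_rotate[of "y \<otimes> (x \<otimes> w)" u] assms by (simp add: m_assoc)
qed

text \<open>
  For a valuation with positive part \<^term>\<open>P\<close> this is the set of all \<open>z\<close> with
  \<open>v x + v z > 0\<close>, so it encodes \<open>v x\<close>.
\<close>

definition conductor :: "'a \<Rightarrow> 'a set" where
  "conductor x = {z \<in> carrier R. x \<otimes> z \<in> P}"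

lemma conductor_subset: "conductor x \<subseteq> carrier R"
  by (auto simp: conductor_def)

lemma conductor_one: "conductor \<one> = P"
  using P_A A_carrier by (auto simp: conductor_def)

lemma P_subset_conductor_iff:
  assumes "x \<in> carrier R"
  shows "P \<subseteq> conductor x \<longleftrightarrow> x \<in> A"
proof
  assume sub: "P \<subseteq> conductor x"
  show "x \<in> A"
  proof (rule ccontr)
    assume "x \<notin> A"
    then obtain y where "y \<in> P" "x \<otimes> y \<in> A - P" using P_lift assms by blast
    then show False using sub by (auto simp: conductor_def)
  qed
next
  assume "x \<in> A"
  show "P \<subseteq> conductor x"
  proof
    fix p assume "p \<in> P"
    then show "p \<in> conductor x"
      using \<open>x \<in> A\<close> P_r_closed[of p x] P_rotate[of p x] P_A A_carrier
      by (auto simp: conductor_def)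
  qed
qed

text \<open>
  Primality of \<^term>\<open>P\<close> in \<^term>\<open>A\<close> persists when one factor is any ring element: if that
  factor lies outside \<^term>\<open>A\<close>, a further multiplication returns it to \<^term>\<open>A - P\<close>
  while keeping a product that was in \<^term>\<open>P\<close> inside \<^term>\<open>P\<close>.
\<close>

lemma mult_notin_P:
  assumes a: "a \<in> A - P" and z: "z \<in> carrier R - P"
  shows "a \<otimes> z \<notin> P"
proof (cases "z \<in> A")
  case True
  then show ?thesis using assms P_prime by blast
next
  case False
  then obtain y where y: "y \<in> P" "z \<otimes> y \<in> A - P"
    using z P_lift by blast
  show ?thesis
  proof
    assume "a \<otimes> z \<in> P"
    then have "a \<otimes> z \<otimes> y \<in> P" using y P_r_closed P_A by blast
    then have "a \<otimes> (z \<otimes> y) \<in> P" using a z y A_carrier P_A by (simp add: m_assoc)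
    then show False using a y P_prime by blast
  qed
qed

lemma conductor_unit:
  assumes "a \<in> A - P"
  shows "conductor a = P"
proof (intro equalityI subsetI)
  show "z \<in> P" if "z \<in> conductor a" for z
    using that mult_notin_P[OF assms] by (auto simp: conductor_def)
  show "z \<in> conductor a" if "z \<in> P" for z
    using that assms P_subset_conductor_iff A_carrier by blast
qed

text \<open>
  The multiplier may be taken in \<^term>\<open>A\<close> in every case, so multiplying by it preserves
  membership in \<^term>\<open>P\<close> elsewhere.
\<close>

lemma lift_to_unit:
  assumes "x \<in> carrier R" "x \<notin> P"
  shows "\<exists>t\<in>A. x \<otimes> t \<in> A - P"
proof (cases "x \<in> A")
  case True
  then show ?thesis using assms subringE(3)[OF A_subring] by (intro bexI[of _ \<one>]) auto
next
  case False
  then show ?thesis using assms P_lift P_A by blast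
qed

text \<open>
  With witnesses \<open>z\<close>, \<open>w\<close> against both inclusions, scaled so that \<open>y z\<close> and
  \<open>x w\<close> lie in \<^term>\<open>A - P\<close>, the product of \<open>x\<close>, \<open>y\<close>, \<open>z\<close>, \<open>w\<close> lies in
  \<^term>\<open>P\<close> when grouped as \<open>(x z) (y w)\<close> and outside it when grouped as \<open>(y z) (x w)\<close>.
\<close>

lemma conductor_linear:
  assumes x: "x \<in> carrier R" and y: "y \<in> carrier R"
  shows "conductor x \<subseteq> conductor y \<or> conductor y \<subseteq> conductor x"
proof (rule ccontr)
  assume "\<not> ?thesis"
  then obtain z w where z: "z \<in> carrier R" "x \<otimes> z \<in> P" "y \<otimes> z \<notin> P"
    and w: "w \<in> carrier R" "y \<otimes> w \<in> P" "x \<otimes> w \<notin> P"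
    by (auto simp: conductor_def)
  obtain t where t: "t \<in> A" "y \<otimes> z \<otimes> t \<in> A - P"
    using lift_to_unit y z by blast
  obtain s where s: "s \<in> A" "x \<otimes> w \<otimes> s \<in> A - P"
    using lift_to_unit x w by blast
  define z' where "z' = z \<otimes> t"
  define w' where "w' = w \<otimes> s"
  have carr: "z' \<in> carrier R" "w' \<in> carrier R" 
    using z w t s A_carrier by (auto simp: z'_def w'_def)
  have xz: "x \<otimes> z' \<in> P"
    using z t x A_carrier P_r_closed[of "x \<otimes> z" t] by (simp add: z'_def m_assoc)
  have yw: "y \<otimes> w' \<in> P"
    using w s y A_carrier P_r_closed[of "y \<otimes> w" s] by (simp add: w'_def m_assoc)
  have yz: "y \<otimes> z' \<in> A - P"
    using z t y A_carrier by (simp add: z'_def m_assoc)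
  have xw: "x \<otimes> w' \<in> A - P"
    using w s x A_carrier by (simp add: w'_def m_assoc)
  have "x \<otimes> z' \<otimes> (y \<otimes> w') \<in> P"
    using xz yw P_r_closed P_A by blast
  then have "y \<otimes> (x \<otimes> z') \<otimes> w' \<in> P"
    using P_swap[of "x \<otimes> z'" y w'] x y carr by (simp add: m_assoc)
  then have "y \<otimes> x \<otimes> (z' \<otimes> w') \<in> P"
    using x y carr by (simp add: m_assoc)
  then have "y \<otimes> z' \<otimes> (x \<otimes> w') \<in> P"
    using P_swap_inner x y carr by blast
  then show False
    using yz xw P_prime by blast
qed

lemma conductor_mult_iff:
  assumes "x \<in> carrier R" "y \<in> carrier R" "z \<in> carrier R"
  shows "z \<in> conductor (x \<otimes> y) \<longleftrightarrow> y \<otimes> z \<in> conductor x"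
  using assms by (simp add: conductor_def m_assoc)

lemma conductor_mult_comm:
  assumes "x \<in> carrier R" "y \<in> carrier R"
  shows "conductor (x \<otimes> y) = conductor (y \<otimes> x)"
  using assms P_swap by (auto simp: conductor_def)

text \<open>
  Since \<open>z\<close> lies in the conductor of \<open>x u\<close> iff \<open>u z\<close> lies in that of \<open>x\<close>, the conductor
  of \<open>x u\<close> depends monotonically on that of \<open>x\<close> alone.  This is both the well-definedness of the
  product of values and the invariance of their order.
\<close>

lemma conductor_mult_mono:
  assumes "x \<in> carrier R" "y \<in> carrier R" "u \<in> carrier R" "conductor x \<subseteq> conductor y"
  shows "conductor (u \<otimes> x) \<subseteq> conductor (u \<otimes> y)"
proof -
  have "conductor (x \<otimes> u) \<subseteq> conductor (y \<otimes> u)"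
  proof
    fix z assume z: "z \<in> conductor (x \<otimes> u)"
    then have "z \<in> carrier R" using conductor_subset by blast
    then show "z \<in> conductor (y \<otimes> u)" using z assms conductor_mult_iff by blast
  qed
  then show ?thesis using assms conductor_mult_comm by blast
qed

lemma conductor_mult_cong:
  assumes "x \<in> carrier R" "y \<in> carrier R" "u \<in> carrier R" "conductor x = conductor y"
  shows "conductor (u \<otimes> x) = conductor (u \<otimes> y)"
  using conductor_mult_mono assms by (intro equalityI) auto

lemma conductor_proper_inverse:
  assumes "x \<in> carrier R" "conductor x \<noteq> carrier R"
  shows "\<exists>y\<in>carrier R. x \<otimes> y \<in> A - P"
proof -
  obtain z where z: "z \<in> carrier R" "x \<otimes> z \<notin> P"
    using assms by (auto simp: conductor_def)
  then obtain t where "t \<in> A" "x \<otimes> z \<otimes> t \<in> A - P"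
    using lift_to_unit assms by blast
  then show ?thesis
    using assms z A_carrier by (intro bexI[of _ "z \<otimes> t"]) (auto simp: m_assoc)
qed

lemma conductor_mult_improper:
  assumes "x \<in> carrier R" "y \<in> carrier R" "conductor x = carrier R"
  shows "conductor (x \<otimes> y) = carrier R"
  using assms conductor_mult_iff conductor_subset by blast

text \<open>
  Finite values have finite sum: if \<open>x x'\<close> and \<open>y y'\<close> lie in \<^term>\<open>A - P\<close>, then so does
  their product, which keeps \<open>x' y'\<close> out of the conductor of \<open>x y\<close>.
\<close>

lemma conductor_mult_eq_carrier_iff:
  assumes x: "x \<in> carrier R" and y: "y \<in> carrier R"
  shows "conductor (x \<otimes> y) = carrier R \<longleftrightarrow> conductor x = carrier R \<or> conductor y = carrier R"
proof
  assume "conductor x = carrier R \<or> conductor y = carrier R"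
  then show "conductor (x \<otimes> y) = carrier R"
    using conductor_mult_improper conductor_mult_comm x y by metis
next
  assume xy: "conductor (x \<otimes> y) = carrier R"
  show "conductor x = carrier R \<or> conductor y = carrier R"
  proof (rule ccontr)
    assume "\<not> ?thesis"
    then obtain x' y' where x': "x' \<in> carrier R" "x \<otimes> x' \<in> A - P"
      and y': "y' \<in> carrier R" "y \<otimes> y' \<in> A - P"
      using conductor_proper_inverse x y by meson
    have "x' \<otimes> y' \<in> conductor (x \<otimes> y)" using xy x' y' by simp
    then have "x \<otimes> y \<otimes> (x' \<otimes> y') \<in> P" by (simp add: conductor_def)
    then have "x \<otimes> x' \<otimes> (y \<otimes> y') \<in> P" using P_swap_inner x y x' y' by blast
    then show False using x' y' P_prime by blast
  qed
qed

end


section \<open>The Manis valuation\<close>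

context manis_pair
begin

text \<open>
  The conductor of \<open>x y\<close> is the set of all \<open>z\<close> with \<open>y z\<close> in the conductor of \<open>x\<close>.  Reading
  this as a product of sets needs a representative \<open>y\<close> of the second factor only.
\<close>

definition value_mult :: "'a set \<Rightarrow> 'a set \<Rightarrow> 'a set" where
  "value_mult D E = {z \<in> carrier R. \<exists>y\<in>carrier R. conductor y = E \<and> y \<otimes> z \<in> D}"

definition value_group :: "'a set monoid" where
  "value_group = \<lparr>carrier = conductor ` carrier R - {carrier R}, monoid.mult = value_mult, one = P\<rparr>"

definition value_order :: "('a set \<times> 'a set) set" where
  "value_order = {(D, E). D \<in> carrier value_group \<and> E \<in> carrier value_group \<and> D \<subseteq> E}"

definition manis_valuation :: "'a \<Rightarrow> 'a set with_infty" where
  "manis_valuation x = (if conductor x = carrier R then Infty else Fin (conductor x))"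

lemma value_mult_conductor:
  assumes "x \<in> carrier R" "y \<in> carrier R"
  shows "value_mult (conductor x) (conductor y) = conductor (x \<otimes> y)"
proof (intro equalityI subsetI)
  fix z assume "z \<in> value_mult (conductor x) (conductor y)"
  then obtain u where u: "u \<in> carrier R" "conductor u = conductor y" "u \<otimes> z \<in> conductor x"
    and z: "z \<in> carrier R"
    by (auto simp: value_mult_def)
  then have "z \<in> conductor (x \<otimes> u)" using assms conductor_mult_iff by blast
  then show "z \<in> conductor (x \<otimes> y)" using conductor_mult_cong u assms by blast
next
  fix z assume z: "z \<in> conductor (x \<otimes> y)"
  then have "z \<in> carrier R" using conductor_subset by blast
  then show "z \<in> value_mult (conductor x) (conductor y)"
    using z assms conductor_mult_iff by (auto simp: value_mult_def)
qed

lemma value_group_carrierE: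
  assumes "D \<in> carrier value_group"
  obtains x where "x \<in> carrier R" "D = conductor x" "conductor x \<noteq> carrier R"
  using assms by (auto simp: value_group_def)

lemma conductor_in_value_group:
  "\<lbrakk>x \<in> carrier R; conductor x \<noteq> carrier R\<rbrakk> \<Longrightarrow> conductor x \<in> carrier value_group"
  by (auto simp: value_group_def)

lemma value_group_mult:
  assumes "x \<in> carrier R" "y \<in> carrier R"
  shows "conductor x \<otimes>\<^bsub>value_group\<^esub> conductor y = conductor (x \<otimes> y)"
  using value_mult_conductor[OF assms] by (simp add: value_group_def)

lemma value_group_one: "\<one>\<^bsub>value_group\<^esub> = conductor \<one>"
  by (simp add: value_group_def conductor_one)

lemma conductor_one_proper: "conductor \<one> \<noteq> carrier R"
  using conductor_one one_notin_P by auto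

lemma value_group_comm_group: "comm_group value_group"
proof (rule comm_groupI)
  fix D E assume "D \<in> carrier value_group" "E \<in> carrier value_group"
  then obtain x y where x: "x \<in> carrier R" "D = conductor x" "conductor x \<noteq> carrier R"
    and y: "y \<in> carrier R" "E = conductor y" "conductor y \<noteq> carrier R"
    by (elim value_group_carrierE)
  show "D \<otimes>\<^bsub>value_group\<^esub> E \<in> carrier value_group"
    using x y by (simp add: value_group_mult conductor_mult_eq_carrier_iff conductor_in_value_group)
  show "D \<otimes>\<^bsub>value_group\<^esub> E = E \<otimes>\<^bsub>value_group\<^esub> D"
    using x y conductor_mult_comm by (simp add: value_group_mult)
next
  show "\<one>\<^bsub>value_group\<^esub> \<in> carrier value_group"
    using conductor_one_proper by (simp add: value_group_one conductor_in_value_group)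
next
  fix D E F assume "D \<in> carrier value_group" "E \<in> carrier value_group" "F \<in> carrier value_group"
  then show "D \<otimes>\<^bsub>value_group\<^esub> E \<otimes>\<^bsub>value_group\<^esub> F
      = D \<otimes>\<^bsub>value_group\<^esub> (E \<otimes>\<^bsub>value_group\<^esub> F)"
    by (elim value_group_carrierE) (simp add: value_group_mult m_assoc)
next
  fix D assume "D \<in> carrier value_group"
  then obtain x where x: "x \<in> carrier R" "D = conductor x" "conductor x \<noteq> carrier R"
    by (elim value_group_carrierE)
  then show "\<one>\<^bsub>value_group\<^esub> \<otimes>\<^bsub>value_group\<^esub> D = D"
    by (simp add: value_group_one value_group_mult)
  obtain y where y: "y \<in> carrier R" "x \<otimes> y \<in> A - P"
    using conductor_proper_inverse x by blast
  then have "conductor (x \<otimes> y) = conductor \<one>"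
    by (simp add: conductor_unit conductor_one)
  then have yx: "conductor (y \<otimes> x) = conductor \<one>"
    using conductor_mult_comm x y by simp
  then have "conductor y \<noteq> carrier R"
    using conductor_one_proper conductor_mult_eq_carrier_iff x y by metis
  then show "\<exists>E\<in>carrier value_group. E \<otimes>\<^bsub>value_group\<^esub> D = \<one>\<^bsub>value_group\<^esub>"
    using x y yx
    by (intro bexI[of _ "conductor y"])
      (auto simp: value_group_mult value_group_one intro: conductor_in_value_group)
qed

lemma value_group_ordered: "totally_ordered_comm_group value_group value_order"
proof (intro totally_ordered_comm_group.intro value_group_comm_group
    totally_ordered_comm_group_axioms.intro)
  have "total_on (carrier value_group) value_order"
  proof (rule total_onI)
    fix D E assume DE: "D \<in> carrier value_group" "E \<in> carrier value_group"
    then have "D \<subseteq> E \<or> E \<subseteq> D"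
      by (elim value_group_carrierE) (simp add: conductor_linear)
    then show "(D, E) \<in> value_order \<or> (E, D) \<in> value_order"
      using DE by (simp add: value_order_def)
  qed
  then show "linear_order_on (carrier value_group) value_order"
    unfolding order_on_defs
    by (auto simp: value_order_def refl_on_def intro!: transI antisymI)
next
  fix D E F assume DE: "(D, E) \<in> value_order" and F: "F \<in> carrier value_group"
  interpret V: comm_group value_group by (rule value_group_comm_group)
  have DE': "D \<in> carrier value_group" "E \<in> carrier value_group" "D \<subseteq> E"
    using DE by (auto simp: value_order_def)
  obtain x where x: "x \<in> carrier R" "D = conductor x"
    using DE'(1) by (elim value_group_carrierE)
  obtain y where y: "y \<in> carrier R" "E = conductor y"
    using DE'(2) by (elim value_group_carrierE)
  obtain u where "u \<in> carrier R" "F = conductor u"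
    using F by (elim value_group_carrierE)
  then have "F \<otimes>\<^bsub>value_group\<^esub> D \<subseteq> F \<otimes>\<^bsub>value_group\<^esub> E"
    using x y DE' conductor_mult_mono by (simp add: value_group_mult)
  then show "(F \<otimes>\<^bsub>value_group\<^esub> D, F \<otimes>\<^bsub>value_group\<^esub> E) \<in> value_order"
    using F DE' by (simp add: value_order_def)
qed

lemma manis_valuation_le_iff:
  assumes "x \<in> carrier R" "y \<in> carrier R"
  shows "infty_le value_order (manis_valuation x) (manis_valuation y)
    \<longleftrightarrow> conductor x \<subseteq> conductor y"
  using assms conductor_subset[of x] conductor_subset[of y]
  by (auto simp: manis_valuation_def value_order_def conductor_in_value_group)

text \<open>
  As conductors are linearly ordered, the intersection is the smaller of the two, so this is the
  ultrametric inequality.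
\<close>

lemma conductor_add:
  assumes "x \<in> carrier R" "y \<in> carrier R"
  shows "conductor x \<inter> conductor y \<subseteq> conductor (x \<oplus> y)"
  using assms additive_subgroup.a_closed[OF P_subgroup] by (auto simp: conductor_def l_distr)

lemma manis_valuation_is_valuation: "valuation R value_group value_order manis_valuation"
  unfolding valuation_def
proof (intro conjI ballI)
  show "totally_ordered_comm_group value_group value_order"
    by (rule value_group_ordered)
  have zero: "conductor \<zero> = carrier R"
    using additive_subgroup.zero_closed[OF P_subgroup] by (auto simp: conductor_def)
  then show "manis_valuation \<zero> = Infty"
    by (simp add: manis_valuation_def)
  show "manis_valuation ` carrier R = insert Infty (Fin ` carrier value_group)"
  proof (intro equalityI subsetI)
    fix g assume "g \<in> insert Infty (Fin ` carrier value_group)"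
    then consider "g = Infty" | D where "D \<in> carrier value_group" "g = Fin D"
      by blast
    then show "g \<in> manis_valuation ` carrier R"
    proof cases
      case 1
      then have "g = manis_valuation \<zero>" using zero by (simp add: manis_valuation_def)
      then show ?thesis by simp
    next
      case 2
      then obtain x where x: "x \<in> carrier R" "D = conductor x" "conductor x \<noteq> carrier R"
        by (elim value_group_carrierE)
      then have "g = manis_valuation x" using 2 by (simp add: manis_valuation_def)
      then show ?thesis using x by simp
    qed
  next
    fix g assume "g \<in> manis_valuation ` carrier R"
    then obtain x where "x \<in> carrier R" "g = manis_valuation x" by blast
    then show "g \<in> insert Infty (Fin ` carrier value_group)"
      by (simp add: manis_valuation_def conductor_in_value_group)
  qed
  show "manis_valuation \<one> = Fin \<one>\<^bsub>value_group\<^esub>"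
    using conductor_one_proper by (simp add: manis_valuation_def value_group_one)
next
  fix x y assume xy: "x \<in> carrier R" "y \<in> carrier R"
  then show "manis_valuation (x \<otimes> y)
      = infty_add value_group (manis_valuation x) (manis_valuation y)"
    by (simp add: manis_valuation_def conductor_mult_eq_carrier_iff value_group_mult)
  show "infty_le value_order (infty_min value_order (manis_valuation x) (manis_valuation y))
      (manis_valuation (x \<oplus> y))"
    using xy conductor_linear[OF xy] conductor_add[OF xy]
    by (auto simp: infty_min_def manis_valuation_le_iff)
qed

lemma manis_valuation_one: "Fin \<one>\<^bsub>value_group\<^esub> = manis_valuation \<one>"
  using manis_valuation_is_valuation by (simp add: valuation_def)

lemma valuation_subring_manis: "valuation_subring R value_group value_order manis_valuation = A"
  using P_subset_conductor_iff A_carrier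
  by (auto simp: valuation_subring_def manis_valuation_one manis_valuation_le_iff conductor_one)

lemma valuation_prime_manis: "valuation_prime R value_group value_order manis_valuation = P"
proof -
  have "manis_valuation \<one> \<noteq> manis_valuation x \<longleftrightarrow> x \<in> P" if "x \<in> A" for x
  proof
    assume "manis_valuation \<one> \<noteq> manis_valuation x"
    then have "conductor x \<noteq> conductor \<one>"
      unfolding manis_valuation_def by metis
    then show "x \<in> P"
      using conductor_unit that by (auto simp: conductor_one)
  next
    assume "x \<in> P"
    then have "\<one> \<in> conductor x" "\<one> \<notin> conductor \<one>"
      using one_notin_P P_A A_carrier by (auto simp: conductor_def)
    then show "manis_valuation \<one> \<noteq> manis_valuation x"
      using conductor_one_proper by (auto simp: manis_valuation_def split: if_splits)
  qed
  then show ?thesis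
    using P_subset_conductor_iff A_carrier P_A
    by (auto simp: valuation_prime_def infty_less_def manis_valuation_one manis_valuation_le_iff
        conductor_one)
qed

end


section \<open>Superrings are commutative modulo their odd ideal\<close>

context superring
begin

lemma grade_carrier: "x \<in> Gr i \<Longrightarrow> x \<in> carrier R"
  using subgroup.subset[OF grade_subgroup, of i] by auto

lemma grade_decomp:
  assumes "x \<in> carrier R"
  obtains x0 x1 where "x0 \<in> Gr 0" "x1 \<in> Gr 1" "x = x0 \<oplus> x1"
  using assms grade_sum by (auto simp: set_add_def' elim: that)

lemma odd_idealI: "\<lbrakk>r \<in> carrier R; s \<in> Gr 1\<rbrakk> \<Longrightarrow> r \<otimes> s \<in> odd_ideal R Gr"
  unfolding odd_ideal_def by (rule ideal_prod.prod)

lemma odd_ideal_add: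
  "\<lbrakk>x \<in> odd_ideal R Gr; y \<in> odd_ideal R Gr\<rbrakk> \<Longrightarrow> x \<oplus> y \<in> odd_ideal R Gr"
  unfolding odd_ideal_def by (rule ideal_prod.sum)

lemma odd_ideal_carrier: "x \<in> odd_ideal R Gr \<Longrightarrow> x \<in> carrier R"
  unfolding odd_ideal_def by (induction rule: ideal_prod.induct) (auto simp: grade_carrier)

text \<open>
  In \<open>r s (z\<^sub>0 + z\<^sub>1)\<close> with \<open>s\<close> odd, the even part \<open>z\<^sub>0\<close> is central and moves to the left
  of \<open>s\<close>, while in \<open>(r s) z\<^sub>1\<close> the odd factor \<open>z\<^sub>1\<close> is already in last position.
\<close>

lemma odd_ideal_r_closed:
  assumes "x \<in> odd_ideal R Gr" and z: "z \<in> carrier R"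
  shows "x \<otimes> z \<in> odd_ideal R Gr"
  using assms(1) unfolding odd_ideal_def
proof (induction rule: ideal_prod.induct)
  case (prod r s)
  obtain z0 z1 where z01: "z0 \<in> Gr 0" "z1 \<in> Gr 1" "z = z0 \<oplus> z1"
    using grade_decomp z by blast
  note carr = prod(1) grade_carrier[OF prod(2)] grade_carrier[OF z01(1)] grade_carrier[OF z01(2)]
  have "r \<otimes> s \<otimes> z = r \<otimes> z0 \<otimes> s \<oplus> r \<otimes> s \<otimes> z1"
    using carr even_central[OF z01(1), of s] by (simp add: z01(3) r_distr m_assoc)
  moreover have "\<dots> \<in> odd_ideal R Gr"
    using carr prod z01 by (intro odd_ideal_add odd_idealI) auto
  ultimately show ?case
    by (simp add: odd_ideal_def)
next
  case (sum s1 s2)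
  then have "s1 \<in> carrier R" "s2 \<in> carrier R"
    using odd_ideal_carrier by (auto simp: odd_ideal_def)
  then show ?case
    using sum z by (simp add: l_distr ideal_prod.sum)
qed

text \<open>Even parts are central, so only the odd parts contribute to the commutator.\<close>

lemma commutator_in_odd_ideal:
  assumes "x \<in> carrier R" "y \<in> carrier R"
  shows "x \<otimes> y \<ominus> y \<otimes> x \<in> odd_ideal R Gr"
proof -
  obtain x0 x1 where x: "x0 \<in> Gr 0" "x1 \<in> Gr 1" "x = x0 \<oplus> x1"
    using grade_decomp assms(1) by blast
  obtain y0 y1 where y: "y0 \<in> Gr 0" "y1 \<in> Gr 1" "y = y0 \<oplus> y1"
    using grade_decomp assms(2) by blast
  note carr = x(1,2)[THEN grade_carrier] y(1,2)[THEN grade_carrier]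
  \<comment> \<open>Both expansions are arranged to differ in the last summand only.\<close>
  have "x \<otimes> y = x0 \<otimes> y \<oplus> (x1 \<otimes> y0 \<oplus> x1 \<otimes> y1)"
    using carr by (simp add: x(3) y(3) l_distr r_distr a_ac)
  moreover have "y \<otimes> x = x0 \<otimes> y \<oplus> (x1 \<otimes> y0 \<oplus> y1 \<otimes> x1)"
    using carr even_central[OF x(1), of y] even_central[OF y(1), of x1] assms
    by (simp add: x(3) r_distr) (simp add: y(3) l_distr)
  moreover have "(a \<oplus> (b \<oplus> c)) \<ominus> (a \<oplus> (b \<oplus> d)) = c \<oplus> (\<ominus> d)"
    if "a \<in> carrier R" "b \<in> carrier R" "c \<in> carrier R" "d \<in> carrier R" for a b c d
    using that by algebra
  ultimately have "x \<otimes> y \<ominus> y \<otimes> x = x1 \<otimes> y1 \<oplus> (\<ominus> y1) \<otimes> x1"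
    using carr assms by (simp add: l_minus)
  then show ?thesis
    using carr x y by (simp add: odd_ideal_add odd_idealI)
qed

lemma valuation_pair_manis_pair:
  assumes "valuation_pair R Gr A P"
  shows "manis_pair R A P"
proof -
  let ?S = "R\<lparr>carrier := A\<rparr>"
  have A: "subring A R" and id: "ideal P ?S" and dom: "domain (?S Quot P)"
    and odd: "odd_ideal R Gr \<subseteq> P"
    and lift: "\<forall>x\<in>carrier R - A. \<exists>x'\<in>P \<inter> (A \<inter> Gr 0). x \<otimes> x' \<in> A - P"
    using assms by (auto simp: valuation_pair_def subsuperring_def prime_superideal_def)
  interpret I: ideal P ?S by (rule id)
  have PA: "P \<subseteq> A" using I.a_subset by simp
  have "subgroup P (add_monoid R)"
  proof (rule add.subgroupI)
    show "P \<subseteq> carrier R" using PA subringE(1)[OF A] by blast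
    show "P \<noteq> {}" using additive_subgroup.zero_closed[OF I.is_additive_subgroup] by auto
    show "\<ominus> a \<in> P" if "a \<in> P" for a
    proof -
      have aR: "a \<in> carrier R" "a \<in> A" using that PA subringE(1)[OF A] by auto
      have "\<ominus> \<one> \<otimes> a \<in> P"
        using I.I_l_closed[of a "\<ominus> \<one>"] that subringE(3,5)[OF A] by simp
      then show ?thesis using aR by (simp add: l_minus)
    qed
    show "a \<oplus> b \<in> P" if "a \<in> P" "b \<in> P" for a b
      using additive_subgroup.a_closed[OF I.is_additive_subgroup, of a b] that by simp
  qed
  then have sub: "additive_subgroup P R" by (rule additive_subgroupI)
  interpret P: additive_subgroup P R by (rule sub)
  have prime: "\<one> \<notin> P" "\<And>a b. \<lbrakk>a \<in> A; b \<in> A; a \<otimes> b \<in> P\<rbrakk> \<Longrightarrow> a \<in> P \<or> b \<in> P"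
    using dom unfolding domain_Quot_iff[OF id] by auto
  show ?thesis
  proof (intro manis_pair.intro ring_axioms manis_pair_axioms.intro A sub PA prime)
    show "p \<otimes> a \<in> P" if "p \<in> P" "a \<in> A" for p a
      using I.I_r_closed[of p a] that by simp
    show "\<exists>y\<in>P. x \<otimes> y \<in> A - P" if "x \<in> carrier R - A" for x
      using lift that by blast
    fix x y z assume xyz: "x \<in> carrier R" "y \<in> carrier R" "z \<in> carrier R" "x \<otimes> y \<otimes> z \<in> P"
    have "(x \<otimes> y \<ominus> y \<otimes> x) \<otimes> z \<in> P"
      using odd_ideal_r_closed commutator_in_odd_ideal odd xyz by blast
    then have "x \<otimes> y \<otimes> z \<ominus> (x \<otimes> y \<ominus> y \<otimes> x) \<otimes> z \<in> P"
      using xyz(4) by (simp add: a_minus_def P.a_closed P.a_inv_closed)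
    moreover have "x \<otimes> y \<otimes> z \<ominus> (x \<otimes> y \<ominus> y \<otimes> x) \<otimes> z = y \<otimes> x \<otimes> z"
      using xyz by algebra
    ultimately show "y \<otimes> x \<otimes> z \<in> P" by simp
  qed
qed

end


section \<open>Totally ordered groups with infinity\<close>

context totally_ordered_comm_group
begin

lemma ord_carrier: "(a, b) \<in> ord_rel \<Longrightarrow> a \<in> carrier G \<and> b \<in> carrier G"
  using linear_order by (auto simp: order_on_defs)

lemma ord_refl: "a \<in> carrier G \<Longrightarrow> (a, a) \<in> ord_rel"
  using linear_order by (auto simp: order_on_defs refl_on_def)

lemma ord_trans: "\<lbrakk>(a, b) \<in> ord_rel; (b, c) \<in> ord_rel\<rbrakk> \<Longrightarrow> (a, c) \<in> ord_rel"
  using linear_order by (auto simp: order_on_defs dest: transD)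

lemma ord_antisym: "\<lbrakk>(a, b) \<in> ord_rel; (b, a) \<in> ord_rel\<rbrakk> \<Longrightarrow> a = b"
  using linear_order by (auto simp: order_on_defs dest: antisymD)

lemma ord_total: "\<lbrakk>a \<in> carrier G; b \<in> carrier G\<rbrakk> \<Longrightarrow> (a, b) \<in> ord_rel \<or> (b, a) \<in> ord_rel"
  using linear_order ord_refl unfolding order_on_defs total_on_def by metis

lemma ord_mult_ge:
  assumes "(\<one>, g) \<in> ord_rel" "(\<one>, h) \<in> ord_rel"
  shows "(g, g \<otimes> h) \<in> ord_rel"
  using translation_invariant[of \<one> h g] assms ord_carrier[of \<one> g] by auto

lemma infty_le_trans: "\<lbrakk>infty_le ord_rel a b; infty_le ord_rel b c\<rbrakk> \<Longrightarrow> infty_le ord_rel a c"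
  by (cases a; cases b; cases c) (auto intro: ord_trans)

lemma infty_le_antisym: "\<lbrakk>infty_le ord_rel a b; infty_le ord_rel b a\<rbrakk> \<Longrightarrow> a = b"
  by (cases a; cases b) (auto intro: ord_antisym)

lemma infty_less_le_trans:
  "\<lbrakk>infty_less ord_rel a b; infty_le ord_rel b c\<rbrakk> \<Longrightarrow> infty_less ord_rel a c"
  unfolding infty_less_def using infty_le_trans infty_le_antisym by metis

text \<open>A special case of torsion-freeness, needed for the value of \<open>- 1\<close>.\<close>

lemma square_eq_one:
  assumes g: "g \<in> carrier G" "g \<otimes> g = \<one>"
  shows "g = \<one>"
  using ord_total[OF one_closed g(1)]
proof
  assume "(\<one>, g) \<in> ord_rel"
  then show ?thesis using ord_mult_ge[of g g] g ord_antisym by auto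
next
  assume "(g, \<one>) \<in> ord_rel"
  then show ?thesis using translation_invariant[of g \<one> g] g ord_antisym by auto
qed

end


section \<open>The valuation pair of a valuation\<close>

locale valued_superring = superring R Gr for R (structure) and Gr +
  fixes G :: "('g, 'n) monoid_scheme" and ord_rel and v
  assumes v_valuation: "valuation R G ord_rel v"
begin

sublocale vg: totally_ordered_comm_group G ord_rel
  using v_valuation by (simp add: valuation_def)

abbreviation Av where "Av \<equiv> valuation_subring R G ord_rel v"
abbreviation Pv where "Pv \<equiv> valuation_prime R G ord_rel v"

lemma v_image: "v ` carrier R = insert Infty (Fin ` carrier G)"
  and v_zero: "v \<zero> = Infty"
  and v_one: "v \<one> = Fin \<one>\<^bsub>G\<^esub>"
  and v_mult: "\<lbrakk>x \<in> carrier R; y \<in> carrier R\<rbrakk> \<Longrightarrow> v (x \<otimes> y) = infty_add G (v x) (v y)"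
  and v_add: "\<lbrakk>x \<in> carrier R; y \<in> carrier R\<rbrakk> \<Longrightarrow>
    infty_le ord_rel (infty_min ord_rel (v x) (v y)) (v (x \<oplus> y))"
  using v_valuation by (auto simp: valuation_def)

lemma v_cases:
  assumes "x \<in> carrier R"
  obtains "v x = Infty" | g where "g \<in> carrier G" "v x = Fin g"
  using v_image assms by blast

lemma v_minus_one: "v (\<ominus> \<one>) = Fin \<one>\<^bsub>G\<^esub>"
proof -
  have "infty_add G (v (\<ominus> \<one>)) (v (\<ominus> \<one>)) = Fin \<one>\<^bsub>G\<^esub>"
    using v_mult[of "\<ominus> \<one>" "\<ominus> \<one>"] v_one by (simp add: l_minus)
  then show ?thesis
    using v_cases[of "\<ominus> \<one>"] vg.square_eq_one
    by (metis a_inv_closed infty_add.simps(1,2) one_closed with_infty.distinct(1)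
        with_infty.inject)
qed

lemma v_minus:
  assumes "x \<in> carrier R"
  shows "v (\<ominus> x) = v x"
proof -
  have "v (\<ominus> x) = infty_add G (Fin \<one>\<^bsub>G\<^esub>) (v x)"
    using v_mult[of "\<ominus> \<one>" x] v_minus_one assms by (simp add: l_minus)
  then show ?thesis
    by (cases rule: v_cases[OF assms]) auto
qed

lemma v_odd:
  assumes "x \<in> Gr 1"
  shows "v x = Infty"
proof -
  have x: "x \<in> carrier R" using assms grade_carrier by blast
  have "infty_add G (v x) (v x) = Infty"
    using v_mult[OF x x] odd_square[OF assms] v_zero by simp
  then show ?thesis by (cases "v x") auto
qed

lemma v_odd_ideal: "x \<in> odd_ideal R Gr \<Longrightarrow> v x = Infty"
  unfolding odd_ideal_def
proof (induction rule: ideal_prod.induct)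
  case (prod r s)
  then show ?case by (cases "v r") (simp_all add: v_mult v_odd grade_carrier)
next
  case (sum s1 s2)
  then have "infty_le ord_rel Infty (v (s1 \<oplus> s2))"
    using v_add[of s1 s2] odd_ideal_carrier by (auto simp: odd_ideal_def infty_min_def)
  then show ?case by (cases "v (s1 \<oplus> s2)") auto
qed

text \<open>
  The ultrametric inequality gives \<open>v (x + y) \<ge> v x\<close>; applied to \<open>x = (x + y) - y\<close> it gives the
  reverse.
\<close>

lemma v_add_infty:
  assumes "x \<in> carrier R" "y \<in> carrier R" "v y = Infty"
  shows "v (x \<oplus> y) = v x"
proof -
  have ge: "infty_le ord_rel (v z) (v (z \<oplus> w))"
    if "z \<in> carrier R" "w \<in> carrier R" "v w = Infty" for z w
    using v_add[OF that(1,2)] that(3) by (cases "v z") (auto simp: infty_min_def)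
  have "x \<oplus> y \<oplus> \<ominus> y = x"
    using assms by algebra
  then have "infty_le ord_rel (v (x \<oplus> y)) (v x)"
    using ge[of "x \<oplus> y" "\<ominus> y"] assms by (simp add: v_minus)
  then show ?thesis
    using ge[OF assms] vg.infty_le_antisym by blast
qed

lemma in_Av: "x \<in> Av \<longleftrightarrow> x \<in> carrier R \<and> infty_le ord_rel (Fin \<one>\<^bsub>G\<^esub>) (v x)"
  by (simp add: valuation_subring_def)

lemma in_Pv: "x \<in> Pv \<longleftrightarrow> x \<in> Av \<and> v x \<noteq> Fin \<one>\<^bsub>G\<^esub>"
  by (auto simp: valuation_prime_def valuation_subring_def infty_less_def)

lemma infty_in_Pv: "\<lbrakk>x \<in> carrier R; v x = Infty\<rbrakk> \<Longrightarrow> x \<in> Pv"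
  by (simp add: in_Pv in_Av)

lemma v_add_ge:
  assumes "x \<in> carrier R" "y \<in> carrier R"
  shows "infty_le ord_rel (v x) (v (x \<oplus> y)) \<or> infty_le ord_rel (v y) (v (x \<oplus> y))"
  using v_add[OF assms] by (auto simp: infty_min_def split: if_splits)

lemma Av_add: "\<lbrakk>x \<in> Av; y \<in> Av\<rbrakk> \<Longrightarrow> x \<oplus> y \<in> Av"
  unfolding in_Av using v_add_ge vg.infty_le_trans by blast

lemma Pv_add: "\<lbrakk>x \<in> Pv; y \<in> Pv\<rbrakk> \<Longrightarrow> x \<oplus> y \<in> Pv"
  unfolding valuation_prime_def using v_add_ge vg.infty_less_le_trans by (simp, blast)

lemma Av_mult:
  assumes "x \<in> Av" "y \<in> Av"
  shows "x \<otimes> y \<in> Av"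
proof -
  have "infty_le ord_rel (Fin \<one>\<^bsub>G\<^esub>) (infty_add G (v x) (v y))"
    using assms unfolding in_Av
    by (cases "v x"; cases "v y") (auto intro: vg.ord_trans vg.ord_mult_ge)
  then show ?thesis using assms by (simp add: in_Av v_mult)
qed

text \<open>A product of elements \<open>\<ge> 1\<close> of an ordered group is at least each factor, so it is \<open>1\<close>
  only if both are.  This makes the positive part both an ideal and prime.\<close>

lemma v_mult_eq_one_iff:
  assumes "x \<in> Av" "y \<in> Av"
  shows "v (x \<otimes> y) = Fin \<one>\<^bsub>G\<^esub> \<longleftrightarrow> v x = Fin \<one>\<^bsub>G\<^esub> \<and> v y = Fin \<one>\<^bsub>G\<^esub>"
proof -
  have *: "g = \<one>\<^bsub>G\<^esub> \<and> h = \<one>\<^bsub>G\<^esub>"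
    if "(\<one>\<^bsub>G\<^esub>, g) \<in> ord_rel" "(\<one>\<^bsub>G\<^esub>, h) \<in> ord_rel" "g \<otimes>\<^bsub>G\<^esub> h = \<one>\<^bsub>G\<^esub>" for g h
  proof -
    have gh: "g \<in> carrier G" "h \<in> carrier G" using that vg.ord_carrier by auto
    have "g = \<one>\<^bsub>G\<^esub>" using vg.ord_mult_ge[OF that(1,2)] that vg.ord_antisym by simp
    then show ?thesis using that gh by simp
  qed
  show ?thesis
    using assms * unfolding in_Av
    by (cases "v x"; cases "v y") (auto simp: v_mult)
qed

lemma Av_minus: "x \<in> Av \<Longrightarrow> \<ominus> x \<in> Av"
  by (simp add: in_Av v_minus)

lemma Av_one: "\<one> \<in> Av"
  by (simp add: in_Av v_one vg.ord_refl)

lemma Av_subring: "subring Av R"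
  by (rule subringI) (auto simp: Av_add Av_mult Av_minus Av_one, simp add: in_Av)

lemma odd_in_Pv: "x \<in> Gr 1 \<Longrightarrow> x \<in> Pv"
  by (simp add: infty_in_Pv v_odd grade_carrier)

lemma Av_carrier: "x \<in> Av \<Longrightarrow> x \<in> carrier R"
  by (simp add: in_Av)

lemma Pv_Av: "x \<in> Pv \<Longrightarrow> x \<in> Av"
  by (simp add: in_Pv)

lemma Av_even_part:
  assumes "x0 \<in> Gr 0" "x1 \<in> Gr 1" "x0 \<oplus> x1 \<in> Av"
  shows "x0 \<in> Av"
  using assms v_add_infty[of x0 x1] by (simp add: in_Av v_odd grade_carrier)

lemma Av_ring: "ring (R\<lparr>carrier := Av\<rparr>)"
  by (rule subring_is_ring[OF Av_subring])

lemma subgroup_of_Av: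
  assumes "H \<subseteq> Av" "subgroup H (add_monoid R)"
  shows "subgroup H (add_monoid (R\<lparr>carrier := Av\<rparr>))"
  using add.subgroup_incl[OF assms(2) subring.axioms(1)[OF Av_subring] assms(1)] by simp

lemma Av_subsuperring: "subsuperring R Gr Av"
  unfolding subsuperring_def
proof (intro conjI Av_subring superring.intro Av_ring superring_axioms.intro)
  let ?S = "R\<lparr>carrier := Av\<rparr>"
  show "subgroup (Av \<inter> Gr i) (add_monoid ?S)" for i
    using add.subgroups_Inter_pair[OF subring.axioms(1)[OF Av_subring] grade_subgroup[of i]]
    by (intro subgroup_of_Av) auto
  show "(Av \<inter> Gr 0) <+>\<^bsub>?S\<^esub> (Av \<inter> Gr 1) = carrier ?S"
  proof (intro equalityI subsetI)
    fix x assume "x \<in> carrier ?S"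
    then have x: "x \<in> Av" by simp
    then obtain x0 x1 where x01: "x0 \<in> Gr 0" "x1 \<in> Gr 1" "x = x0 \<oplus> x1"
      using grade_decomp Av_carrier by blast
    then have "x0 \<in> Av" "x1 \<in> Av"
      using Av_even_part x odd_in_Pv Pv_Av by auto
    then show "x \<in> (Av \<inter> Gr 0) <+>\<^bsub>?S\<^esub> (Av \<inter> Gr 1)"
      using x01 by (auto simp: set_add_def')
  qed (auto simp: set_add_def' Av_add)
  show "(Av \<inter> Gr 0) \<inter> (Av \<inter> Gr 1) = {\<zero>\<^bsub>?S\<^esub>}"
    using grade_Int subringE(2)[OF Av_subring] by auto
  show "x \<otimes>\<^bsub>?S\<^esub> y \<in> Av \<inter> Gr (i + j)" if "x \<in> Av \<inter> Gr i" "y \<in> Av \<inter> Gr j" for x y i j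
    using that Av_mult grade_mult by simp
  show "\<one>\<^bsub>?S\<^esub> \<noteq> \<zero>\<^bsub>?S\<^esub>" using one_neq_zero by simp
  show "x \<otimes>\<^bsub>?S\<^esub> y = y \<otimes>\<^bsub>?S\<^esub> x" if "x \<in> Av \<inter> Gr 0" "y \<in> carrier ?S" for x y
    using that even_central[of x y] Av_carrier[of y] by simp
  show "x \<otimes>\<^bsub>?S\<^esub> x = \<zero>\<^bsub>?S\<^esub>" if "x \<in> Av \<inter> Gr 1" for x
    using that odd_square by simp
qed

lemma Pv_ideal: "ideal Pv (R\<lparr>carrier := Av\<rparr>)"
proof (rule idealI[OF Av_ring subgroup_of_Av])
  show "Pv \<subseteq> Av" using Pv_Av by blast
  show "subgroup Pv (add_monoid R)"
  proof (rule add.subgroupI)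
    show "Pv \<noteq> {}" using infty_in_Pv[of \<zero>] v_zero by auto
    show "\<ominus> a \<in> Pv" if "a \<in> Pv" for a
      using that by (simp add: in_Pv Av_minus v_minus Av_carrier)
  qed (auto simp: Pv_add dest: Pv_Av Av_carrier)
qed (auto simp: in_Pv Av_mult v_mult_eq_one_iff)

lemma minus_Av:
  assumes "a \<in> Av"
  shows "\<ominus>\<^bsub>R\<lparr>carrier := Av\<rparr>\<^esub> a = \<ominus> a"
proof -
  interpret S: ring "R\<lparr>carrier := Av\<rparr>" by (rule Av_ring)
  show ?thesis
    using S.minus_equality[of "\<ominus> a" a] assms Av_minus Av_carrier by (simp add: l_neg)
qed

lemma Pv_prime: "prime_superideal Pv (R\<lparr>carrier := Av\<rparr>)"
  unfolding prime_superideal_def domain_Quot_iff[OF Pv_ideal]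
proof (intro conjI Pv_ideal ballI impI)
  let ?S = "R\<lparr>carrier := Av\<rparr>"
  show "\<one>\<^bsub>?S\<^esub> \<notin> Pv" by (simp add: in_Pv v_one)
  fix a b assume "a \<in> carrier ?S" "b \<in> carrier ?S"
  then have ab: "a \<in> Av" "b \<in> Av" by auto
  have "a \<otimes> b \<ominus> b \<otimes> a \<in> Pv"
    using commutator_in_odd_ideal[of a b] ab Av_carrier v_odd_ideal odd_ideal_carrier infty_in_Pv
    by blast
  then show "a \<otimes>\<^bsub>?S\<^esub> b \<ominus>\<^bsub>?S\<^esub> b \<otimes>\<^bsub>?S\<^esub> a \<in> Pv"
    using ab by (simp add: a_minus_def minus_Av Av_mult)
  show "a \<in> Pv \<or> b \<in> Pv" if "a \<otimes>\<^bsub>?S\<^esub> b \<in> Pv"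
    using that ab by (auto simp: in_Pv v_mult_eq_one_iff)
qed

text \<open>
  By surjectivity some \<open>y\<close> has the value inverse to that of \<open>x\<close>, and its even part has the same
  value because odd elements have value \<open>\<infinity>\<close>.
\<close>

lemma Pv_lift:
  assumes "x \<in> carrier R - Av"
  shows "\<exists>y\<in>Pv \<inter> (Av \<inter> Gr 0). x \<otimes> y \<in> Av - Pv"
proof -
  have x: "x \<in> carrier R" and neg: "\<not> infty_le ord_rel (Fin \<one>\<^bsub>G\<^esub>) (v x)"
    using assms by (auto simp: in_Av)
  then obtain g where g: "g \<in> carrier G" "v x = Fin g"
    by (cases rule: v_cases[of x]) auto
  let ?h = "inv\<^bsub>G\<^esub> g"
  obtain y where y: "y \<in> carrier R" "v y = Fin ?h"
  proof -
    have "Fin ?h \<in> v ` carrier R" using g by (simp add: v_image)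
    then show ?thesis using that by (metis imageE)
  qed
  obtain y0 y1 where y01: "y0 \<in> Gr 0" "y1 \<in> Gr 1" "y = y0 \<oplus> y1"
    using grade_decomp y by blast
  then have vy0: "v y0 = Fin ?h"
    using v_add_infty[of y0 y1] y by (simp add: v_odd grade_carrier)
  have y0: "y0 \<in> carrier R" using y01 grade_carrier by blast
  have "(g, \<one>\<^bsub>G\<^esub>) \<in> ord_rel"
    using neg g vg.ord_total[of g "\<one>\<^bsub>G\<^esub>"] by auto
  then have "(\<one>\<^bsub>G\<^esub>, ?h) \<in> ord_rel"
    using vg.translation_invariant[of g "\<one>\<^bsub>G\<^esub>" ?h] g by simp
  moreover have "?h \<noteq> \<one>\<^bsub>G\<^esub>"
    using neg g vg.ord_refl by (metis infty_le.simps(1) vg.inv_eq_1_iff vg.one_closed)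
  ultimately have "y0 \<in> Pv"
    using y0 vy0 by (simp add: in_Pv in_Av)
  moreover have "v (x \<otimes> y0) = Fin \<one>\<^bsub>G\<^esub>"
    using x y0 g vy0 by (simp add: v_mult)
  then have "x \<otimes> y0 \<in> Av - Pv"
    using x y0 vg.ord_refl by (simp add: in_Pv in_Av)
  ultimately show ?thesis
    using y01 Pv_Av by blast
qed

lemma valuation_pair_Av_Pv: "valuation_pair R Gr Av Pv"
  unfolding valuation_pair_def
  using Av_subsuperring Pv_prime Pv_lift v_odd_ideal odd_ideal_carrier infty_in_Pv by blast

end


section \<open>Valuation pairs come from valuations\<close>

theorem proposition2p5:
  fixes R :: "('a, 'm) ring_scheme" and Gr :: "bit \<Rightarrow> 'a set"
  assumes "superring R Gr"
  shows "(\<forall>A P. valuation_pair R Gr A P \<longrightarrow>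
            (\<exists>(G :: 'a set monoid) ord_rel v. valuation R G ord_rel v \<and>
               A = valuation_subring R G ord_rel v \<and> P = valuation_prime R G ord_rel v)) \<and>
         (\<forall>(G :: ('g, 'n) monoid_scheme) ord_rel v. valuation R G ord_rel v \<longrightarrow>
            valuation_pair R Gr (valuation_subring R G ord_rel v) (valuation_prime R G ord_rel v))"
proof (intro conjI allI impI)
  interpret superring R Gr by fact
  fix A P assume "valuation_pair R Gr A P"
  then interpret M: manis_pair R A P by (rule valuation_pair_manis_pair)
  show "\<exists>(G :: 'a set monoid) ord_rel v. valuation R G ord_rel v \<and>
      A = valuation_subring R G ord_rel v \<and> P = valuation_prime R G ord_rel v"
    using M.manis_valuation_is_valuation M.valuation_subring_manis M.valuation_prime_manis by blast
next
  fix G :: "('g, 'n) monoid_scheme" and ord_rel v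
  assume "valuation R G ord_rel v"
  then interpret valued_superring R Gr G ord_rel v
    using assms by (intro valued_superring.intro valued_superring_axioms.intro)
  show "valuation_pair R Gr (valuation_subring R G ord_rel v) (valuation_prime R G ord_rel v)"
    by (rule valuation_pair_Av_Pv)
qed

end
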